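(* Let $p$ be a prime and $m\ge1$ an integer. Let $(a_n^{(m+1)})_{n\in\mathbb{N}}$ be a sequence of nonzero elements of $\mathbb{Q}$ with $a_0^{(m+1)}=1$. Let $s^{(i)}:\mathbb{Q}_p\to\mathbb{Q}$ ($i=1,\dots,m-1$) and $s_n^{(m)}:\mathbb{Q}_p\to\mathbb{Q}$ ($n\in\mathbb{N}$) be functions such that $s^{(i)}(0)=s_n^{(m)}(0)=0$ and, for every $\gamma\in\mathbb{Q}_p^*$, $$|\gamma-s^{(i)}(\gamma)|<\min\{|\gamma|,1\}\ (i=1,\dots,m-1),\qquad |\gamma-s_n^{(m)}(\gamma)|<\min\{|\gamma|,1\},\qquad |\gamma-s_n^{(m)}(\gamma)|\le |a_{n+1}^{(m+1)}|$$ for all $n\in\mathbb{N}$, where $|\cdot|$ is the $p$-adic absolute value. Given $\alpha^{(1)}=\alpha_0^{(1)},\dots,\alpha^{(m)}=\alpha_0^{(m)}\in\mathbb{Q}_p$, define recursively for $n=0,1,2,\dots$ $$a_n^{(i)}=s^{(i)}(\alpha_n^{(i)})\ (i=1,\dots,m-1),\quad a_n^{(m)}=s_n^{(m)}(\alpha_n^{(m)}),$$ $$\alpha_{n+1}^{(1)}=\frac{a_{n+1}^{(m+1)}}{\alpha_n^{(m)}-a_n^{(m)}},\qquad \alpha_{n+1}^{(i)}=a_{n+1}^{(m+1)}\frac{\alpha_n^{(i-1)}-a_n^{(i-1)}}{\alpha_n^{(m)}-a_n^{(m)}}\ (i=2,\dots,m),$$ and $\alpha_n^{(m+1)}=a_n^{(m+1)}$;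 assume this recursion can be carried out for every $n$ (i.e. $\alpha_n^{(m)}\ne a_n^{(m)}$ for all $n\ge0$). Let $A_{-j}^{(i)}=\delta_{ij}$ ($j=1,\dots,m$, $i=1,\dots,m+1$), $A_0^{(i)}=a_0^{(i)}$, $A_n^{(i)}=\sum_{j=1}^{m+1}a_n^{(j)}A_{n-j}^{(i)}$ for $n\ge1$, and set $V_n^{(i)}=A_n^{(i)}-\alpha^{(i)}A_n^{(m+1)}$ for $n\ge -m$, $i=1,\dots,m$. Then $\lim_{n\to\infty}V_n^{(i)}=0$ in $\mathbb{Q}_p$ for each $i=1,\dots,m$.
   Context: $\delta_{ij}$ is the Kronecker delta. This expresses strong convergence of the multidimensional continued fraction with partial quotients $a_n^{(i)}$. *)

theory Defs
  imports Complex_Main "Berlekamp_Zassenhaus.Finite_Field"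
begin

text \<open>
  The field of \<open>p\<close>-adic numbers is constructed as the completion of the rationals with respect
  to the \<open>p\<close>-adic absolute value: Cauchy sequences of rationals modulo null sequences. The prime
  is a type parameter, \<open>p = CARD('p)\<close> with \<open>'p\<close> in class \<^class>\<open>prime_card\<close>.
\<close>

section \<open>The p-adic absolute value on the rationals\<close>

definition padic_val :: "nat \<Rightarrow> rat \<Rightarrow> int" where
  "padic_val p q = int (multiplicity (int p) (fst (quotient_of q)))
                 - int (multiplicity (int p) (snd (quotient_of q)))"

definition padic_abs :: "nat \<Rightarrow> rat \<Rightarrow> real" where
  "padic_abs p q = (if q = 0 then 0 else real p powi (- padic_val p q))"

lemma padic_val_Fract:
  assumes p: "prime p" and ab: "a \<noteq> 0" "b \<noteq> 0"
  shows "padic_val p (Rat.Fract a b) = int (multiplicity (int p) a) - int (multiplicity (int p) b)"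
proof -
  obtain c d where cd: "quotient_of (Rat.Fract a b) = (c, d)" by fastforce
  have d: "d > 0" using quotient_of_denom_pos[OF cd] .
  have eq: "Rat.Fract a b = Rat.Fract c d" using cd by (metis quotient_of_eq)
  hence e: "a * d = c * b" using ab d by (simp add: eq_rat)
  have c: "c \<noteq> 0" using e ab d by auto
  have pe: "prime_elem (int p)" using p by auto
  have "multiplicity (int p) a + multiplicity (int p) d
      = multiplicity (int p) c + multiplicity (int p) b"
    using prime_elem_multiplicity_mult_distrib[OF pe, of a d]
      prime_elem_multiplicity_mult_distrib[OF pe, of c b] e ab c d by simp
  thus ?thesis by (simp add: padic_val_def cd)
qed

lemma padic_abs_0 [simp]: "padic_abs p 0 = 0"
  by (simp add: padic_abs_def)

lemma padic_abs_ge_0 [simp]: "padic_abs p q \<ge> 0"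
  by (simp add: padic_abs_def)

lemma padic_abs_eq_0_iff [simp]: "prime p \<Longrightarrow> padic_abs p q = 0 \<longleftrightarrow> q = 0"
  using prime_gt_0_nat[of p] by (auto simp: padic_abs_def)

lemma padic_abs_1 [simp]: "padic_abs p 1 = 1"
  by (simp add: padic_abs_def padic_val_def)

lemma padic_abs_minus [simp]: "padic_abs p (- q) = padic_abs p q"
proof -
  have "multiplicity (int p) (- a) = multiplicity (int p) a" for a
    by (metis abs_minus_cancel multiplicity_normalize_right normalize_int_def)
  thus ?thesis by (simp add: padic_abs_def padic_val_def rat_uminus_code case_prod_beta Let_def)
qed

lemma padic_abs_minus_commute: "padic_abs p (x - y) = padic_abs p (y - x)"
  by (metis minus_diff_eq padic_abs_minus)

lemma padic_abs_mult:
  assumes p: "prime p"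
  shows "padic_abs p (x * y) = padic_abs p x * padic_abs p y"
proof (cases "x = 0 \<or> y = 0")
  case False
  obtain a b where x: "x = Rat.Fract a b" "b > 0" by (cases x) auto
  obtain c d where y: "y = Rat.Fract c d" "d > 0" by (cases y) auto
  have nz: "a \<noteq> 0" "c \<noteq> 0" using False x y by (auto simp: rat_number_collapse)
  have pe: "prime_elem (int p)" using p by auto
  have p0: "real p \<noteq> 0" using prime_gt_0_nat[OF p] by simp
  have "padic_val p (x * y) = padic_val p x + padic_val p y"
    using nz x y padic_val_Fract[OF p]
    by (simp add: prime_elem_multiplicity_mult_distrib[OF pe])
  thus ?thesis using False p0
    by (simp add: padic_abs_def power_int_add power_int_diff power_int_minus divide_simps)
qed (auto simp: padic_abs_def)

lemma padic_abs_inverse: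
  assumes p: "prime p"
  shows "padic_abs p (inverse x) = inverse (padic_abs p x)"
proof (cases "x = 0")
  case False
  have "padic_abs p (inverse x) * padic_abs p x = 1"
    using False padic_abs_mult[OF p, of "inverse x" x] by simp
  thus ?thesis by (metis inverse_unique mult.commute)
qed simp

lemma padic_abs_ultra:
  assumes p: "prime p"
  shows "padic_abs p (x + y) \<le> max (padic_abs p x) (padic_abs p y)"
proof (cases "x = 0 \<or> y = 0 \<or> x + y = 0")
  case False
  obtain a b where x: "x = Rat.Fract a b" "b > 0" by (cases x) auto
  obtain c d where y: "y = Rat.Fract c d" "d > 0" by (cases y) auto
  have nz: "a \<noteq> 0" "c \<noteq> 0" using False x y by (auto simp: rat_number_collapse)
  define u v w where "u = a * d" and "v = c * b" and "w = b * d"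
  have u0: "u \<noteq> 0" "v \<noteq> 0" "w \<noteq> 0" using nz x y by (auto simp: u_def v_def w_def)
  have X: "x = Rat.Fract u w" "y = Rat.Fract v w" using x y by (auto simp: u_def v_def w_def eq_rat)
  have XY: "x + y = Rat.Fract (u + v) w"
    using X u0 by (simp add: eq_rat algebra_simps)
  have uv: "u + v \<noteq> 0" using False XY by (auto simp: rat_number_collapse)
  let ?m = "multiplicity (int p)"
  have "int p ^ min (?m u) (?m v) dvd u + v"
    by (intro dvd_add) (auto intro: multiplicity_dvd')
  hence "min (?m u) (?m v) \<le> ?m (u + v)"
    using uv p prime_gt_1_nat[OF p] by (intro multiplicity_geI) (auto simp: zdvd1_eq)
  hence m: "min (padic_val p x) (padic_val p y) \<le> padic_val p (x + y)"
    using padic_val_Fract[OF p] u0 uv X XY by simp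
  have p1: "1 \<le> real p" using prime_gt_0_nat[OF p] by linarith
  have "real p powi (- padic_val p (x + y)) \<le> real p powi max (- padic_val p x) (- padic_val p y)"
    using m p1 by (intro power_int_increasing) linarith+
  also have "\<dots> \<le> max (real p powi (- padic_val p x)) (real p powi (- padic_val p y))"
    by (simp add: max_def)
  finally show ?thesis using False by (simp add: padic_abs_def)
qed (auto simp: le_max_iff_disj)

lemma padic_abs_triangle:
  "prime p \<Longrightarrow> padic_abs p (x + y) \<le> padic_abs p x + padic_abs p y"
  using padic_abs_ultra[of p x y] padic_abs_ge_0[of p x] padic_abs_ge_0[of p y] by linarith

lemma padic_abs_diff_triangle:
  "prime p \<Longrightarrow> padic_abs p (x - y) \<le> padic_abs p x + padic_abs p y"
  using padic_abs_triangle[of p x "- y"] by simp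

lemma padic_abs_diff_abs:
  assumes "prime p"
  shows "\<bar>padic_abs p x - padic_abs p y\<bar> \<le> padic_abs p (x - y)"
  using padic_abs_triangle[OF assms, of "x - y" y] padic_abs_triangle[OF assms, of "y - x" x]
  by (simp add: padic_abs_minus_commute[of p y x] abs_le_iff)


section \<open>Cauchy sequences and null sequences\<close>

definition padic_cauchy :: "nat \<Rightarrow> (nat \<Rightarrow> rat) \<Rightarrow> bool" where
  "padic_cauchy p X \<longleftrightarrow> (\<forall>e>0. \<exists>k. \<forall>m\<ge>k. \<forall>n\<ge>k. padic_abs p (X m - X n) < e)"

definition padic_null :: "nat \<Rightarrow> (nat \<Rightarrow> rat) \<Rightarrow> bool" where
  "padic_null p X \<longleftrightarrow> (\<lambda>n. padic_abs p (X n)) \<longlonglongrightarrow> 0"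

lemma padic_null_const [simp]: "prime p \<Longrightarrow> padic_null p (\<lambda>n. c) \<longleftrightarrow> c = 0"
  by (simp add: padic_null_def LIMSEQ_const_iff)

lemma padic_null_dominated:
  assumes "padic_null p X" "eventually (\<lambda>n. padic_abs p (Y n) \<le> C * padic_abs p (X n)) sequentially"
  shows "padic_null p Y"
proof -
  have "(\<lambda>n. C * padic_abs p (X n)) \<longlonglongrightarrow> 0"
    using assms(1) tendsto_mult_right_zero unfolding padic_null_def by blast
  thus ?thesis unfolding padic_null_def
    by (rule tendsto_sandwich[OF _ assms(2) tendsto_const, rotated]) simp
qed

lemma padic_null_add:
  assumes p: "prime p" and "padic_null p X" "padic_null p Y"
  shows "padic_null p (\<lambda>n. X n + Y n)"
proof -
  have "(\<lambda>n. padic_abs p (X n) + padic_abs p (Y n)) \<longlonglongrightarrow> 0"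
    using assms(2,3) unfolding padic_null_def by (rule tendsto_add_zero)
  thus ?thesis unfolding padic_null_def
    by (rule tendsto_sandwich[OF _ _ tendsto_const, rotated 2])
      (simp_all add: padic_abs_triangle[OF p])
qed

lemma padic_null_minus: "padic_null p X \<Longrightarrow> padic_null p (\<lambda>n. - X n)"
  by (simp add: padic_null_def)

lemma padic_null_diff:
  "prime p \<Longrightarrow> padic_null p X \<Longrightarrow> padic_null p Y \<Longrightarrow> padic_null p (\<lambda>n. X n - Y n)"
  using padic_null_add[of p X "\<lambda>n. - Y n"] padic_null_minus[of p Y] by simp

lemma padic_null_diff_commute:
  "padic_null p (\<lambda>n. X n - Y n) \<longleftrightarrow> padic_null p (\<lambda>n. Y n - X n)"
  by (simp add: padic_null_def padic_abs_minus_commute)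

lemma padic_cauchy_const [simp]: "padic_cauchy p (\<lambda>n. c)"
  by (simp add: padic_cauchy_def)

lemma padic_cauchy_minus [simp]: "padic_cauchy p X \<Longrightarrow> padic_cauchy p (\<lambda>n. - X n)"
proof -
  have "padic_abs p (- X m - - X n) = padic_abs p (X m - X n)" for m n
    by (metis minus_diff_minus padic_abs_minus)
  thus "padic_cauchy p X \<Longrightarrow> padic_cauchy p (\<lambda>n. - X n)" by (simp only: padic_cauchy_def)
qed

lemma padic_cauchy_add [simp]:
  assumes p: "prime p" and "padic_cauchy p X" "padic_cauchy p Y"
  shows "padic_cauchy p (\<lambda>n. X n + Y n)"
  unfolding padic_cauchy_def
proof (intro allI impI)
  fix e :: real assume e: "e > 0"
  obtain k where k: "\<forall>m\<ge>k. \<forall>n\<ge>k. padic_abs p (X m - X n) < e"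
    using assms(2) e unfolding padic_cauchy_def by meson
  obtain l where l: "\<forall>m\<ge>l. \<forall>n\<ge>l. padic_abs p (Y m - Y n) < e"
    using assms(3) e unfolding padic_cauchy_def by meson
  have "padic_abs p (X m + Y m - (X n + Y n)) < e" if "m \<ge> max k l" "n \<ge> max k l" for m n
  proof -
    have "padic_abs p (X m - X n) < e" "padic_abs p (Y m - Y n) < e" using k l that by auto
    thus ?thesis
      using padic_abs_ultra[OF p, of "X m - X n" "Y m - Y n"] by (simp add: add_diff_add)
  qed
  thus "\<exists>k. \<forall>m\<ge>k. \<forall>n\<ge>k. padic_abs p (X m + Y m - (X n + Y n)) < e" by blast
qed

lemma padic_cauchy_diff:
  "prime p \<Longrightarrow> padic_cauchy p X \<Longrightarrow> padic_cauchy p Y \<Longrightarrow> padic_cauchy p (\<lambda>n. X n - Y n)"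
  using padic_cauchy_add[of p X "\<lambda>n. - Y n"] padic_cauchy_minus[of p Y] by simp

lemma padic_cauchy_abs_convergent:
  assumes p: "prime p" and X: "padic_cauchy p X"
  shows "convergent (\<lambda>n. padic_abs p (X n))"
proof -
  have "Cauchy (\<lambda>n. padic_abs p (X n))"
    unfolding Cauchy_def dist_real_def
    using X padic_abs_diff_abs[OF p] unfolding padic_cauchy_def by (meson le_less_trans)
  thus ?thesis by (rule Cauchy_convergent)
qed

lemma padic_cauchy_bounded:
  assumes p: "prime p" and X: "padic_cauchy p X"
  obtains B where "B > 0" "\<And>n. padic_abs p (X n) \<le> B"
proof -
  have "Bseq (\<lambda>n. padic_abs p (X n))"
    using convergent_imp_Bseq padic_cauchy_abs_convergent[OF assms] by blast
  then obtain B where "B > 0" "\<And>n. norm (padic_abs p (X n)) \<le> B" unfolding Bseq_def by blast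
  thus ?thesis by (intro that[of B]) simp_all
qed

lemma padic_cauchy_mult [simp]:
  assumes p: "prime p" and X: "padic_cauchy p X" and Y: "padic_cauchy p Y"
  shows "padic_cauchy p (\<lambda>n. X n * Y n)"
  unfolding padic_cauchy_def
proof (intro allI impI)
  fix e :: real assume e: "e > 0"
  obtain B where B: "B > 0" "\<And>n. padic_abs p (X n) \<le> B" using padic_cauchy_bounded[OF p X] by metis
  obtain C where C: "C > 0" "\<And>n. padic_abs p (Y n) \<le> C" using padic_cauchy_bounded[OF p Y] by metis
  obtain k where k: "\<forall>m\<ge>k. \<forall>n\<ge>k. padic_abs p (X m - X n) < e / C"
    using X e C divide_pos_pos unfolding padic_cauchy_def by meson
  obtain l where l: "\<forall>m\<ge>l. \<forall>n\<ge>l. padic_abs p (Y m - Y n) < e / B"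
    using Y e B divide_pos_pos unfolding padic_cauchy_def by meson
  have "padic_abs p (X m * Y m - X n * Y n) < e" if "m \<ge> max k l" "n \<ge> max k l" for m n
  proof -
    have a: "padic_abs p (X m - X n) < e / C" "padic_abs p (Y m - Y n) < e / B" using k l that by auto
    have "padic_abs p (X m) * padic_abs p (Y m - Y n) \<le> B * padic_abs p (Y m - Y n)"
      using B by (intro mult_right_mono) auto
    also have "\<dots> < e" using a B by (simp add: pos_less_divide_eq mult.commute)
    finally have 1: "padic_abs p (X m * (Y m - Y n)) < e" by (simp add: padic_abs_mult[OF p])
    have "padic_abs p (X m - X n) * padic_abs p (Y n) \<le> padic_abs p (X m - X n) * C"
      using C by (intro mult_left_mono) auto
    also have "\<dots> < e" using a C by (simp add: pos_less_divide_eq)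
    finally have 2: "padic_abs p ((X m - X n) * Y n) < e" by (simp add: padic_abs_mult[OF p])
    show ?thesis
      using padic_abs_ultra[OF p, of "X m * (Y m - Y n)" "(X m - X n) * Y n"] 1 2
      by (simp add: mult_diff_mult)
  qed
  thus "\<exists>k. \<forall>m\<ge>k. \<forall>n\<ge>k. padic_abs p (X m * Y m - X n * Y n) < e" by blast
qed

lemma padic_cauchy_not_null:
  assumes p: "prime p" and X: "padic_cauchy p X" "\<not> padic_null p X"
  obtains b k where "b > 0" "\<And>n. n \<ge> k \<Longrightarrow> b < padic_abs p (X n)"
proof -
  obtain L where L: "(\<lambda>n. padic_abs p (X n)) \<longlonglongrightarrow> L"
    using padic_cauchy_abs_convergent[OF p X(1)] unfolding convergent_def by blast
  have "L \<noteq> 0" using L X(2) by (auto simp: padic_null_def)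
  moreover have "L \<ge> 0" using L by (rule LIMSEQ_le_const) simp
  ultimately have "L / 2 > 0" "L / 2 < L" by auto
  thus ?thesis using order_tendstoD(1)[OF L \<open>L / 2 < L\<close>] that
    unfolding eventually_sequentially by blast
qed

lemma padic_abs_inverse_diff:
  assumes p: "prime p" and "0 < a" "0 < b" "a < padic_abs p x" "b < padic_abs p y"
  shows "padic_abs p (inverse x - inverse y) \<le> inverse (a * b) * padic_abs p (x - y)"
proof -
  have nz: "x \<noteq> 0" "y \<noteq> 0" using assms by auto
  have "inverse x - inverse y = inverse (x * y) * (y - x)"
    using nz by (simp add: field_simps)
  hence "padic_abs p (inverse x - inverse y)
      = inverse (padic_abs p x * padic_abs p y) * padic_abs p (x - y)"
    using padic_abs_minus_commute[of p x y] by (simp add: padic_abs_mult[OF p] padic_abs_inverse[OF p])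
  also have "\<dots> \<le> inverse (a * b) * padic_abs p (x - y)"
    using assms by (intro mult_right_mono le_imp_inverse_le mult_mono mult_pos_pos) auto
  finally show ?thesis .
qed

lemma padic_cauchy_inverse [simp]:
  assumes p: "prime p" and X: "padic_cauchy p X" "\<not> padic_null p X"
  shows "padic_cauchy p (\<lambda>n. inverse (X n))"
  unfolding padic_cauchy_def
proof (intro allI impI)
  fix e :: real assume e: "e > 0"
  obtain b k where b: "b > 0" "\<And>n. n \<ge> k \<Longrightarrow> b < padic_abs p (X n)"
    using padic_cauchy_not_null[OF p X] by metis
  have "e * (b * b) > 0" using e b by simp
  then obtain l where l: "\<forall>m\<ge>l. \<forall>n\<ge>l. padic_abs p (X m - X n) < e * (b * b)"
    using X unfolding padic_cauchy_def by meson
  have "padic_abs p (inverse (X m) - inverse (X n)) < e" if "m \<ge> max k l" "n \<ge> max k l" for m n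
  proof -
    have "padic_abs p (inverse (X m) - inverse (X n)) \<le> inverse (b * b) * padic_abs p (X m - X n)"
      using b that by (intro padic_abs_inverse_diff[OF p]) auto
    also have "\<dots> < inverse (b * b) * (e * (b * b))"
      using b l that by (intro mult_strict_left_mono) auto
    also have "\<dots> = e" using b by (simp add: field_simps)
    finally show ?thesis .
  qed
  thus "\<exists>k. \<forall>m\<ge>k. \<forall>n\<ge>k. padic_abs p (inverse (X m) - inverse (X n)) < e" by blast
qed

lemma padic_null_diff_inverse:
  assumes p: "prime p" and X: "padic_cauchy p X" "\<not> padic_null p X"
    and Y: "padic_cauchy p Y" "\<not> padic_null p Y" and XY: "padic_null p (\<lambda>n. X n - Y n)"
  shows "padic_null p (\<lambda>n. inverse (X n) - inverse (Y n))"
proof -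
  obtain a k where a: "a > 0" "\<And>n. n \<ge> k \<Longrightarrow> a < padic_abs p (X n)"
    using padic_cauchy_not_null[OF p X] by metis
  obtain b l where b: "b > 0" "\<And>n. n \<ge> l \<Longrightarrow> b < padic_abs p (Y n)"
    using padic_cauchy_not_null[OF p Y] by metis
  show ?thesis
  proof (rule padic_null_dominated[OF XY])
    show "\<forall>\<^sub>F n in sequentially. padic_abs p (inverse (X n) - inverse (Y n))
            \<le> inverse (a * b) * padic_abs p (X n - Y n)"
      using eventually_ge_at_top[of "max k l"]
      by eventually_elim (rule padic_abs_inverse_diff[OF p a(1) b(1) a(2) b(2)], auto)
  qed
qed

lemma padic_null_mult_cauchy:
  assumes p: "prime p" and X: "padic_cauchy p X" and Y: "padic_null p Y"
  shows "padic_null p (\<lambda>n. X n * Y n)"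
proof -
  obtain B where B: "\<And>n. padic_abs p (X n) \<le> B" using padic_cauchy_bounded[OF p X] by metis
  show ?thesis
    by (rule padic_null_dominated[OF Y, of _ B])
      (auto simp: padic_abs_mult[OF p] intro!: always_eventually mult_right_mono B)
qed


section \<open>The field of p-adic numbers\<close>

typedef ('p::prime_card) padic_seq = "{X. padic_cauchy CARD('p) X}"
  by (rule exI[of _ "\<lambda>_. 0"]) simp

setup_lifting type_definition_padic_seq

instantiation padic_seq :: (prime_card) comm_ring_1
begin

lift_definition zero_padic_seq :: "'a padic_seq" is "\<lambda>_. 0" by simp

lift_definition one_padic_seq :: "'a padic_seq" is "\<lambda>_. 1" by simp

lift_definition plus_padic_seq :: "'a padic_seq \<Rightarrow> 'a padic_seq \<Rightarrow> 'a padic_seq"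
  is "\<lambda>X Y n. X n + Y n" by (simp add: prime_card)

lift_definition uminus_padic_seq :: "'a padic_seq \<Rightarrow> 'a padic_seq"
  is "\<lambda>X n. - X n" by simp

lift_definition minus_padic_seq :: "'a padic_seq \<Rightarrow> 'a padic_seq \<Rightarrow> 'a padic_seq"
  is "\<lambda>X Y n. X n - Y n"
  by (rule padic_cauchy_diff[OF prime_card])

lift_definition times_padic_seq :: "'a padic_seq \<Rightarrow> 'a padic_seq \<Rightarrow> 'a padic_seq"
  is "\<lambda>X Y n. X n * Y n" by (simp add: prime_card)

instance
  by standard (transfer; simp add: algebra_simps fun_eq_iff)+

end

lift_definition null_seq :: "'p::prime_card padic_seq \<Rightarrow> bool" is "padic_null CARD('p)" .

lift_definition const_seq :: "rat \<Rightarrow> 'p::prime_card padic_seq" is "\<lambda>q n. q" by simp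

lift_definition inverse_seq :: "'p::prime_card padic_seq \<Rightarrow> 'p padic_seq"
  is "\<lambda>X. if padic_null CARD('p) X then (\<lambda>n. 0) else (\<lambda>n. inverse (X n))"
  by (simp add: prime_card)

lift_definition abs_seq :: "'p::prime_card padic_seq \<Rightarrow> nat \<Rightarrow> real"
  is "\<lambda>X n. padic_abs CARD('p) (X n)" .

lemma null_seq_iff: "null_seq X \<longleftrightarrow> abs_seq X \<longlonglongrightarrow> 0"
  by transfer (simp add: padic_null_def)

lemma null_seq_0 [simp]: "null_seq 0"
  by transfer (simp add: prime_card)

lemma null_seq_add: "null_seq X \<Longrightarrow> null_seq Y \<Longrightarrow> null_seq (X + Y)"
  by transfer (rule padic_null_add[OF prime_card])

lemma null_seq_minus: "null_seq X \<Longrightarrow> null_seq (- X)"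
  by transfer (rule padic_null_minus)

lemma null_seq_diff: "null_seq X \<Longrightarrow> null_seq Y \<Longrightarrow> null_seq (X - Y)"
  using null_seq_add[of X "- Y"] null_seq_minus[of Y] by simp

lemma null_seq_mult: "null_seq Y \<Longrightarrow> null_seq (X * Y)"
  by transfer (rule padic_null_mult_cauchy[OF prime_card])

lemma abs_seq_convergent: "convergent (abs_seq X)"
  by transfer (rule padic_cauchy_abs_convergent[OF prime_card])

lemma abs_seq_mult: "abs_seq (X * Y) = (\<lambda>n. abs_seq X n * abs_seq Y n)"
  by transfer (simp add: padic_abs_mult[OF prime_card])

lemma abs_seq_ultra: "abs_seq (X + Y) n \<le> max (abs_seq X n) (abs_seq Y n)"
  by transfer (rule padic_abs_ultra[OF prime_card])

lemma abs_seq_diff_abs: "\<bar>abs_seq X n - abs_seq Y n\<bar> \<le> abs_seq (X - Y) n"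
  by transfer (rule padic_abs_diff_abs[OF prime_card])

lemma abs_seq_ge_0: "abs_seq X n \<ge> 0"
  by transfer simp

lemma abs_seq_minus: "abs_seq (- X) = abs_seq X"
  by transfer simp

lemma inverse_seq_null: "null_seq X \<Longrightarrow> inverse_seq X = 0"
  by transfer simp

lemma null_seq_inverse:
  assumes "\<not> null_seq X"
  shows "null_seq (inverse_seq X * X - 1)"
  using assms
proof transfer
  fix X :: "nat \<Rightarrow> rat"
  assume X: "padic_cauchy CARD('a) X" "\<not> padic_null CARD('a) X"
  obtain b k where b: "b > 0" "\<And>n. n \<ge> k \<Longrightarrow> b < padic_abs CARD('a) (X n)"
    using padic_cauchy_not_null[OF prime_card X] by metis
  have "X n \<noteq> 0" if "n \<ge> k" for n using b(1) b(2)[OF that] by auto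
  hence "\<forall>\<^sub>F n in sequentially. padic_abs CARD('a) (inverse (X n) * X n - 1) = 0"
    by (auto intro: eventually_mono[OF eventually_ge_at_top[of k]])
  thus "padic_null CARD('a) (\<lambda>n. (if padic_null CARD('a) X then \<lambda>n. 0
          else (\<lambda>n. inverse (X n))) n * X n - 1)"
    using X unfolding padic_null_def by (simp add: tendsto_eventually)
qed

lemma null_seq_inverse_diff:
  assumes "null_seq (X - Y)"
  shows "null_seq (inverse_seq X - inverse_seq Y)"
proof -
  have iff: "null_seq X \<longleftrightarrow> null_seq Y"
    using null_seq_add[OF assms, of Y] null_seq_diff[of X "X - Y"] assms by auto
  show ?thesis
  proof (cases "null_seq X")
    case True
    thus ?thesis using iff by (simp add: inverse_seq_null)
  next
    case False
    hence "\<not> null_seq Y" using iff by simp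
    with False assms show ?thesis
      by transfer (simp add: padic_null_diff_inverse[OF prime_card])
  qed
qed

definition padic_rel :: "'p::prime_card padic_seq \<Rightarrow> 'p padic_seq \<Rightarrow> bool" where
  "padic_rel X Y \<longleftrightarrow> null_seq (X - Y)"

lemma equivp_padic_rel: "equivp padic_rel"
proof (rule equivpI)
  show "reflp padic_rel" by (simp add: reflp_def padic_rel_def)
  show "symp padic_rel" using null_seq_minus by (fastforce simp: symp_def padic_rel_def)
  show "transp padic_rel" using null_seq_add by (fastforce simp: transp_def padic_rel_def)
qed

quotient_type (overloaded) 'p padic = "'p::prime_card padic_seq" / padic_rel
  morphisms rep_padic Padic
  by (rule equivp_padic_rel)

instantiation padic :: (prime_card) field
begin

lift_definition zero_padic :: "'a padic" is "0" .

lift_definition one_padic :: "'a padic" is "1" .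

lift_definition plus_padic :: "'a padic \<Rightarrow> 'a padic \<Rightarrow> 'a padic" is "(+)"
  unfolding padic_rel_def by (simp add: add_diff_add null_seq_add)

lift_definition uminus_padic :: "'a padic \<Rightarrow> 'a padic" is "uminus"
  unfolding padic_rel_def by (metis minus_diff_minus null_seq_minus)

lift_definition minus_padic :: "'a padic \<Rightarrow> 'a padic \<Rightarrow> 'a padic" is "(-)"
proof -
  fix X X' Y Y' :: "'a padic_seq"
  assume "padic_rel X X'" "padic_rel Y Y'"
  hence "null_seq ((X - X') - (Y - Y'))" unfolding padic_rel_def by (rule null_seq_diff)
  thus "padic_rel (X - Y) (X' - Y')" unfolding padic_rel_def by (simp add: algebra_simps)
qed

lift_definition times_padic :: "'a padic \<Rightarrow> 'a padic \<Rightarrow> 'a padic" is "(*)"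
proof -
  fix X X' Y Y' :: "'a padic_seq"
  assume "padic_rel X X'" "padic_rel Y Y'"
  hence "null_seq (X * (Y - Y') + Y' * (X - X'))"
    unfolding padic_rel_def by (intro null_seq_add null_seq_mult)
  thus "padic_rel (X * Y) (X' * Y')" unfolding padic_rel_def by (simp add: algebra_simps)
qed

lift_definition inverse_padic :: "'a padic \<Rightarrow> 'a padic" is inverse_seq
  unfolding padic_rel_def by (rule null_seq_inverse_diff)

definition divide_padic :: "'a padic \<Rightarrow> 'a padic \<Rightarrow> 'a padic" where
  "divide_padic x y = x * inverse y"

instance
proof
  fix a b c :: "'a padic"
  show "a + b + c = a + (b + c)" by transfer (simp add: padic_rel_def)
  show "a + b = b + a" by transfer (simp add: padic_rel_def)
  show "0 + a = a" by transfer (simp add: padic_rel_def)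
  show "- a + a = 0" by transfer (simp add: padic_rel_def)
  show "a - b = a + - b" by transfer (simp add: padic_rel_def)
  show "a * b * c = a * (b * c)" by transfer (simp add: padic_rel_def algebra_simps)
  show "a * b = b * a" by transfer (simp add: padic_rel_def algebra_simps)
  show "1 * a = a" by transfer (simp add: padic_rel_def)
  show "(a + b) * c = a * c + b * c" by transfer (simp add: padic_rel_def algebra_simps)
  show "(0 :: 'a padic) \<noteq> 1"
    by transfer (simp add: padic_rel_def, transfer, simp add: padic_null_def LIMSEQ_const_iff)
  show "a \<noteq> 0 \<Longrightarrow> inverse a * a = 1"
    by transfer (simp add: padic_rel_def null_seq_inverse)
  show "a div b = a * inverse b" by (rule divide_padic_def)
  show "inverse (0 :: 'a padic) = 0"
    by transfer (simp add: padic_rel_def inverse_seq_null)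
qed

end


section \<open>Absolute value and topology\<close>

text \<open>
  The library's \<open>norm\<close> is constrained to real normed vector spaces, so the absolute value, the
  limit of the absolute values along a representing Cauchy sequence, gets a constant of its own;
  it induces the metric below.
\<close>

lift_definition padic_norm :: "'a::prime_card padic \<Rightarrow> real" is "\<lambda>X. lim (abs_seq X)"
proof -
  fix X Y :: "'a::prime_card padic_seq"
  assume "padic_rel X Y"
  hence "abs_seq (X - Y) \<longlonglongrightarrow> 0" by (simp add: padic_rel_def null_seq_iff)
  hence "(\<lambda>n. abs_seq X n - abs_seq Y n) \<longlonglongrightarrow> 0"
    by (rule tendsto_0_le[where K = 1]) (simp add: abs_seq_diff_abs abs_seq_ge_0)
  moreover have "abs_seq X \<longlonglongrightarrow> lim (abs_seq X)" "abs_seq Y \<longlonglongrightarrow> lim (abs_seq Y)"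
    using abs_seq_convergent convergent_LIMSEQ_iff by blast+
  ultimately show "lim (abs_seq X) = lim (abs_seq Y)"
    using LIMSEQ_unique tendsto_diff by fastforce
qed

lemma abs_seq_tendsto_norm: "abs_seq X \<longlonglongrightarrow> padic_norm (Padic X)"
  using abs_seq_convergent[of X] by (simp add: padic_norm.abs_eq convergent_LIMSEQ_iff)

lemma padic_norm_ultra: "padic_norm (x + y) \<le> max (padic_norm x) (padic_norm (y :: 'a::prime_card padic))"
proof (induct x, induct y)
  fix X Y :: "'a::prime_card padic_seq"
  have "(\<lambda>n. max (abs_seq X n) (abs_seq Y n)) \<longlonglongrightarrow> max (padic_norm (Padic X)) (padic_norm (Padic Y))"
    by (intro tendsto_max abs_seq_tendsto_norm)
  moreover have "abs_seq (X + Y) \<longlonglongrightarrow> padic_norm (Padic X + Padic Y)"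
    using abs_seq_tendsto_norm[of "X + Y"] by (simp add: plus_padic.abs_eq)
  ultimately show "padic_norm (Padic X + Padic Y) \<le> max (padic_norm (Padic X)) (padic_norm (Padic Y))"
    by (intro LIMSEQ_le) (auto intro: abs_seq_ultra)
qed

lemma padic_norm_eq_0 [simp]: "padic_norm x = 0 \<longleftrightarrow> x = (0 :: 'a::prime_card padic)"
proof (induct x)
  fix X :: "'a::prime_card padic_seq"
  have "Padic X = 0 \<longleftrightarrow> null_seq X"
    by (simp add: zero_padic_def padic.abs_eq_iff padic_rel_def)
  also have "\<dots> \<longleftrightarrow> padic_norm (Padic X) = 0"
    using abs_seq_tendsto_norm[of X] LIMSEQ_unique by (auto simp: null_seq_iff)
  finally show "padic_norm (Padic X) = 0 \<longleftrightarrow> Padic X = 0" ..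
qed

lemma padic_norm_minus [simp]: "padic_norm (- x) = padic_norm (x :: 'a::prime_card padic)"
  by transfer (simp add: abs_seq_minus)

lemma padic_norm_0 [simp]: "padic_norm 0 = 0"
  by simp

lemma padic_norm_ge_0 [simp]: "padic_norm (x :: 'a::prime_card padic) \<ge> 0"
  using padic_norm_ultra[of x "- x"] by simp

instantiation padic :: (prime_card) metric_space
begin

definition dist_padic :: "'a padic \<Rightarrow> 'a padic \<Rightarrow> real" where
  "dist_padic x y = padic_norm (x - y)"

definition uniformity_padic :: "('a padic \<times> 'a padic) filter" where
  "uniformity_padic = (INF e\<in>{0 <..}. principal {(x, y). dist x y < e})"

definition open_padic :: "'a padic set \<Rightarrow> bool" where
  "open_padic U \<longleftrightarrow> (\<forall>x\<in>U. eventually (\<lambda>(x', y). x' = x \<longrightarrow> y \<in> U) uniformity)"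

instance
proof
  fix x y z :: "'a padic"
  show "dist x y = 0 \<longleftrightarrow> x = y" by (simp add: dist_padic_def padic_norm_eq_0)
  show "dist x y \<le> dist x z + dist y z"
    using padic_norm_ultra[of "x - z" "z - y"] padic_norm_minus[of "z - y"]
      padic_norm_ge_0[of "x - z"] padic_norm_ge_0[of "y - z"]
    unfolding dist_padic_def minus_diff_eq by (simp only: diff_add_cancel add_diff_eq)
  show "uniformity = (INF e\<in>{0 <..}. principal {(x :: 'a padic, y). dist x y < e})"
    by (rule uniformity_padic_def)
  show "open U \<longleftrightarrow> (\<forall>x\<in>U. eventually (\<lambda>(x', y). x' = x \<longrightarrow> y \<in> U) uniformity)"
    for U :: "'a padic set" by (rule open_padic_def)
qed

end

lemma padic_norm_mult: "padic_norm (x * y) = padic_norm x * padic_norm y" for x y :: "'p::prime_card padic"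
proof (induct x, induct y)
  fix X Y :: "'p padic_seq"
  have "abs_seq (X * Y) \<longlonglongrightarrow> padic_norm (Padic X) * padic_norm (Padic Y)"
    unfolding abs_seq_mult by (intro tendsto_mult abs_seq_tendsto_norm)
  moreover have "abs_seq (X * Y) \<longlonglongrightarrow> padic_norm (Padic X * Padic Y)"
    using abs_seq_tendsto_norm[of "X * Y"] by (simp add: times_padic.abs_eq)
  ultimately show "padic_norm (Padic X * Padic Y) = padic_norm (Padic X) * padic_norm (Padic Y)"
    using LIMSEQ_unique by blast
qed

lemma of_nat_padic: "of_nat k = Padic (const_seq (of_nat k) :: 'p::prime_card padic_seq)"
proof (induct k)
  case 0
  have "const_seq 0 = (0 :: 'p padic_seq)" by transfer simp
  thus ?case by (simp add: zero_padic_def)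
next
  case (Suc k)
  have "const_seq (of_nat (Suc k)) = 1 + (const_seq (of_nat k) :: 'p padic_seq)"
    by transfer simp
  thus ?case using Suc by (simp add: one_padic_def plus_padic.abs_eq)
qed

lemma norm_Padic_const:
  "padic_norm (Padic (const_seq q :: 'p::prime_card padic_seq)) = padic_abs CARD('p) q"
proof -
  have "abs_seq (const_seq q :: 'p padic_seq) = (\<lambda>_. padic_abs CARD('p) q)" by transfer simp
  thus ?thesis using abs_seq_tendsto_norm[of "const_seq q :: 'p padic_seq"]
    by (simp add: LIMSEQ_const_iff)
qed

instance padic :: (prime_card) field_char_0
proof
  show "inj (of_nat :: nat \<Rightarrow> 'a padic)"
  proof (rule injI)
    have *: "m = n" if eq: "(of_nat m :: 'a padic) = of_nat n" and le: "m \<le> n" for m n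
    proof -
      have "(of_nat (n - m) :: 'a padic) = 0" using eq le by (simp add: of_nat_diff)
      hence "padic_norm (of_nat (n - m) :: 'a padic) = 0" by simp
      hence "padic_abs CARD('a) (of_nat (n - m)) = 0" unfolding of_nat_padic norm_Padic_const .
      thus ?thesis using le by (simp add: prime_card)
    qed
    fix m n assume "(of_nat m :: 'a padic) = of_nat n"
    thus "m = n" using *[of m n] *[of n m] by (cases "m \<le> n") auto
  qed
qed

lemma of_rat_padic: "of_rat q = Padic (const_seq q :: 'p::prime_card padic_seq)"
proof -
  have mult: "Padic (const_seq r) * Padic (const_seq s)
      = Padic (const_seq (r * s) :: 'p padic_seq)" for r s
  proof -
    have "const_seq r * const_seq s = (const_seq (r * s) :: 'p padic_seq)" by transfer simp
    thus ?thesis by (simp add: times_padic.abs_eq)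
  qed
  have of_int: "of_int k = Padic (const_seq (of_int k) :: 'p padic_seq)" for k
  proof (cases k)
    case (nonneg n) thus ?thesis by (simp add: of_nat_padic)
  next
    case (neg n)
    have "- const_seq r = (const_seq (- r) :: 'p padic_seq)" for r by transfer simp
    hence "- Padic (const_seq r) = Padic (const_seq (- r) :: 'p padic_seq)" for r
      by (simp add: uminus_padic.abs_eq)
    thus ?thesis using neg of_nat_padic[of "Suc n", where 'p = 'p] by (metis of_int_minus of_int_of_nat_eq)
  qed
  obtain a b where q: "q = Rat.Fract a b" "b > 0" by (cases q) auto
  have "of_rat q * of_int b = (of_int a :: 'p padic)" using q by (simp add: of_rat_rat)
  also have "\<dots> = Padic (const_seq (q * of_int b))"
    using q by (simp add: of_int Rat.Fract_of_int_quotient)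
  also have "\<dots> = Padic (const_seq q) * of_int b" by (simp add: of_int mult)
  finally show ?thesis using q by simp
qed

lemma padic_norm_of_rat [simp]:
  "padic_norm (of_rat q :: 'p::prime_card padic) = padic_abs CARD('p) q"
  by (simp add: of_rat_padic norm_Padic_const)

text \<open>The rationals are dense, and the space is complete.\<close>

lemma Padic_limit:
  "(\<lambda>n. of_rat (Rep_padic_seq X n)) \<longlonglongrightarrow> Padic (X :: 'p::prime_card padic_seq)"
proof (rule metric_LIMSEQ_I)
  fix e :: real assume "e > 0"
  hence e2: "e / 2 > 0" by simp
  have "padic_cauchy CARD('p) (Rep_padic_seq X)" using Rep_padic_seq by blast
  then obtain k where k: "\<forall>m\<ge>k. \<forall>n\<ge>k. padic_abs CARD('p) (Rep_padic_seq X m - Rep_padic_seq X n) < e / 2"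
    using e2 unfolding padic_cauchy_def by blast
  have "dist (of_rat (Rep_padic_seq X n)) (Padic X) < e" if n: "n \<ge> k" for n
  proof -
    let ?c = "const_seq (Rep_padic_seq X n) :: 'p padic_seq"
    have "abs_seq (?c - X) m = padic_abs CARD('p) (Rep_padic_seq X n - Rep_padic_seq X m)" for m
      by (simp add: abs_seq.rep_eq minus_padic_seq.rep_eq const_seq.rep_eq)
    hence "\<exists>N. \<forall>m\<ge>N. abs_seq (?c - X) m \<le> e / 2"
      using k n by (intro exI[of _ k]) (auto simp: less_imp_le)
    hence "padic_norm (Padic (?c - X)) \<le> e / 2"
      using abs_seq_tendsto_norm[of "?c - X"] LIMSEQ_le_const2 by blast
    thus ?thesis using \<open>e > 0\<close> by (simp add: dist_padic_def of_rat_padic minus_padic.abs_eq)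
  qed
  thus "\<exists>k. \<forall>n\<ge>k. dist (of_rat (Rep_padic_seq X n)) (Padic X) < e" by blast
qed

lemma padic_rat_dense:
  fixes x :: "'p::prime_card padic"
  assumes "e > 0"
  shows "\<exists>q. dist (of_rat q) x < e"
proof (induct x)
  fix X :: "'p padic_seq"
  show "\<exists>q. dist (of_rat q) (Padic X) < e"
    using metric_LIMSEQ_D[OF Padic_limit assms, of X] by blast
qed

instance padic :: (prime_card) complete_space
proof
  fix x :: "nat \<Rightarrow> 'a padic"
  assume x: "Cauchy x"
  have "\<exists>q. dist (of_rat q) (x n) < inverse (real (Suc n))" for n
    by (rule padic_rat_dense) simp
  then obtain r where r: "\<And>n. dist (of_rat (r n)) (x n) < inverse (real (Suc n))" by metis
  have lim: "(\<lambda>n. dist (of_rat (r n)) (x n)) \<longlonglongrightarrow> 0"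
    by (rule tendsto_sandwich[OF _ _ tendsto_const LIMSEQ_inverse_real_of_nat])
      (use less_imp_le[OF r] in simp_all)
  have "padic_cauchy CARD('a) r"
    unfolding padic_cauchy_def
  proof (intro allI impI)
    fix e :: real assume "e > 0"
    hence e3: "e / 3 > 0" by simp
    obtain k where k: "\<forall>m\<ge>k. \<forall>n\<ge>k. dist (x m) (x n) < e / 3" using x e3 unfolding Cauchy_def by blast
    obtain l where l: "\<forall>n\<ge>l. dist (of_rat (r n)) (x n) < e / 3"
      using LIMSEQ_D[OF lim e3] by auto
    have "padic_abs CARD('a) (r m - r n) < e" if "m \<ge> max k l" "n \<ge> max k l" for m n
    proof -
      have "dist (of_rat (r m)) (x m) < e / 3" "dist (of_rat (r n)) (x n) < e / 3"
        "dist (x m) (x n) < e / 3" using k l that by auto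
      hence "dist (of_rat (r m)) (of_rat (r n) :: 'a padic) < e"
        using dist_triangle[of "of_rat (r m)" "of_rat (r n)" "x m"]
          dist_triangle[of "x m" "of_rat (r n)" "x n"] by (simp add: dist_commute)
      thus ?thesis by (metis dist_padic_def of_rat_diff padic_norm_of_rat)
    qed
    thus "\<exists>k. \<forall>m\<ge>k. \<forall>n\<ge>k. padic_abs CARD('a) (r m - r n) < e" by blast
  qed
  hence "Rep_padic_seq (Abs_padic_seq r :: 'a padic_seq) = r" by (simp add: Abs_padic_seq_inverse)
  hence "(\<lambda>n. of_rat (r n)) \<longlonglongrightarrow> Padic (Abs_padic_seq r :: 'a padic_seq)"
    using Padic_limit[of "Abs_padic_seq r :: 'a padic_seq"] by simp
  then obtain y :: "'a padic" where y: "(\<lambda>n. of_rat (r n)) \<longlonglongrightarrow> y" by blast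
  have "(\<lambda>n. dist (of_rat (r n)) y) \<longlonglongrightarrow> 0" using y by (rule iffD1[OF tendsto_dist_iff])
  hence *: "(\<lambda>n. dist (of_rat (r n)) (x n) + dist (of_rat (r n)) y) \<longlonglongrightarrow> 0"
    by (rule tendsto_add_zero[OF lim])
  have le: "dist (x n) y \<le> dist (of_rat (r n)) (x n) + dist (of_rat (r n)) y" for n
    by (rule dist_triangle3)
  have "(\<lambda>n. dist (x n) y) \<longlonglongrightarrow> 0"
    by (rule tendsto_sandwich[OF _ _ tendsto_const *]) (simp_all add: le)
  hence "x \<longlonglongrightarrow> y" by (rule iffD2[OF tendsto_dist_iff])
  thus "convergent x" by (rule convergentI)
qed

end

theory Submission
  imports Defs
begin

text \<open>
  Write \<open>\<gamma> j n\<close> for the remainder \<open>\<alpha> j n - a j n\<close>. The recursion for \<open>\<alpha>\<close> shows that the relation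
  \<open>V i n + (\<Sum>j = 1..m. \<gamma> j n * V i (n - j)) = 0\<close> propagates from \<open>n\<close> to \<open>n + 1\<close>.
  All remainders have norm below \<open>1\<close>, hence at most \<open>1 / p\<close> because the value group is discrete,
  so the ultrametric inequality makes each \<open>V i n\<close> smaller by a factor \<open>1 / p\<close> than one of
  its \<open>m\<close> predecessors.
\<close>

text \<open>By density some rational \<open>q\<close> is closer to \<open>x\<close> than
  \<open>padic_norm x\<close>, and the ultrametric inequality then forces \<open>q\<close> and
  \<open>x\<close> to have equal norm. This carries the discreteness of the value group over from
  the rationals.\<close>

lemma padic_norm_eq_padic_abs:
  fixes x :: "'p::prime_card padic"
  obtains q where "padic_norm x = padic_abs CARD('p) q"
proof (cases "x = 0")
  case True
  then show ?thesis using that[of 0] by simp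
next
  case False
  then have "padic_norm x > 0"
    using padic_norm_ge_0[of x] padic_norm_eq_0[of x] by linarith
  then obtain q where "dist (of_rat q) x < padic_norm x"
    using padic_rat_dense by blast
  then have q: "padic_norm (of_rat q - x) < padic_norm x"
    by (simp add: dist_padic_def)
  have "padic_norm (of_rat q :: 'p padic) \<le> padic_norm x"
    using padic_norm_ultra[of "of_rat q - x" x] q by simp
  moreover have "padic_norm x \<le> padic_norm (of_rat q :: 'p padic)"
    using padic_norm_ultra[of "of_rat q" "- (of_rat q - x)"] q
      padic_norm_minus[of "of_rat q - x"] by (simp del: minus_diff_eq)
  ultimately show ?thesis using that[of q] by simp
qed

text \<open>Nonzero values are integer powers of \<open>p\<close>, so a value below 1 has exponent
  at most -1. This turns a strict bound into a uniform contraction factor.\<close>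

lemma padic_abs_less_1_imp_le:
  assumes p: "prime p" and "padic_abs p q < 1"
  shows "padic_abs p q \<le> 1 / real p"
proof (cases "q = 0")
  case False
  have p1: "real p > 1" using prime_gt_1_nat[OF p] by simp
  have "padic_val p q > 0"
  proof (rule ccontr)
    assume "\<not> padic_val p q > 0"
    then have "1 \<le> real p powi (- padic_val p q)"
      using p1 by (intro one_le_power_int) auto
    then show False using assms False by (simp add: padic_abs_def)
  qed
  then have "real p powi (- padic_val p q) \<le> real p powi (- 1)"
    using p1 by (intro power_int_increasing) auto
  then show ?thesis using False by (simp add: padic_abs_def power_int_minus divide_inverse)
qed simp

lemma padic_norm_less_1_imp_le:
  fixes x :: "'p::prime_card padic"
  assumes "padic_norm x < 1"
  shows "padic_norm x \<le> 1 / real CARD('p)"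
  using assms padic_norm_eq_padic_abs[of x] padic_abs_less_1_imp_le[OF prime_card] by metis

text \<open>The ultrametric inequality for finite sums, stated with a witness because the index of a
  dominating summand later selects the predecessor to compare with.\<close>

lemma padic_norm_sum_le:
  fixes f :: "'i \<Rightarrow> 'p::prime_card padic"
  assumes "finite I" "I \<noteq> {}"
  shows "\<exists>i\<in>I. padic_norm (\<Sum>i\<in>I. f i) \<le> padic_norm (f i)"
  using assms
proof (induction I rule: finite_ne_induct)
  case (insert i I)
  then show ?case
    using padic_norm_ultra[of "f i" "\<Sum>i\<in>I. f i"]
    by (auto simp: max_def split: if_splits intro: order_trans)
qed simp

text \<open>Going back at most \<open>m\<close> places gains a factor \<open>c\<close>, so about
  \<open>n div m\<close> such factors accumulate before the initial block of \<open>m\<close>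
  values, bounded by \<open>M\<close>, is reached.\<close>

lemma tendsto_0_if_contracts_predecessor:
  fixes u :: "nat \<Rightarrow> real"
  assumes m: "m \<ge> 1" and c: "0 \<le> c" "c < 1" and nonneg: "\<And>n. u n \<ge> 0"
    and contr: "\<And>n. n \<ge> m \<Longrightarrow> \<exists>j\<in>{1..m}. u n \<le> c * u (n - j)"
  shows "u \<longlonglongrightarrow> 0"
proof -
  define M where "M = Max (u ` {..<m})"
  have M: "u n \<le> M" if "n < m" for n
    using that by (simp add: M_def)
  then have M0: "M \<ge> 0" using m nonneg[of 0] order_trans[of 0 "u 0" M] by simp
  have bound: "u n \<le> M * c ^ (n div m)" for n
  proof (induction n rule: less_induct)
    case (less n)
    show ?case
    proof (cases "n < m")
      case True
      then show ?thesis using M by simp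
    next
      case False
      then obtain j where j: "j \<in> {1..m}" "u n \<le> c * u (n - j)"
        using contr[of n] by auto
      \<comment> \<open>Since j \<le> m, a step back by \<open>j\<close> lowers the quotient by
        \<open>m\<close> by at most one, and the factor \<open>c\<close> just gained makes up for
        that.\<close>
      have "n div m = Suc ((n - m) div m)"
        using False m by (simp add: le_div_geq)
      also have "\<dots> \<le> Suc ((n - j) div m)"
        using j by (simp add: div_le_mono diff_le_mono2)
      finally have le: "n div m \<le> Suc ((n - j) div m)" .
      have "u (n - j) \<le> M * c ^ ((n - j) div m)"
        using j False m by (intro less.IH) auto
      then have "u n \<le> M * c ^ Suc ((n - j) div m)"
        using j(2) mult_left_mono[OF _ c(1)] by (fastforce simp: mult.left_commute)
      also have "\<dots> \<le> M * c ^ (n div m)"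
        using c M0 le by (intro mult_left_mono power_decreasing) auto
      finally show ?thesis .
    qed
  qed
  have "filterlim (\<lambda>n. n div m) at_top at_top"
    unfolding filterlim_at_top eventually_sequentially
  proof (intro allI exI impI)
    fix k n :: nat
    assume "k * m \<le> n"
    then show "k \<le> n div m" using m by (simp add: less_eq_div_iff_mult_less_eq)
  qed
  then have "(\<lambda>n. c ^ (n div m)) \<longlonglongrightarrow> 0"
    using c filterlim_compose[OF LIMSEQ_realpow_zero] by blast
  then have "(\<lambda>n. M * c ^ (n div m)) \<longlonglongrightarrow> 0"
    by (rule tendsto_mult_right_zero)
  then show ?thesis
    by (rule tendsto_sandwich[OF _ _ tendsto_const, rotated 2]) (simp_all add: nonneg bound)
qed

theorem theorem3p5:
  fixes m :: nat
    and a :: "nat \<Rightarrow> nat \<Rightarrow> rat"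
    and s :: "nat \<Rightarrow> 'p::prime_card padic \<Rightarrow> rat"
    and sm :: "nat \<Rightarrow> 'p padic \<Rightarrow> rat"
    and \<alpha> :: "nat \<Rightarrow> nat \<Rightarrow> 'p padic"
    and A :: "nat \<Rightarrow> int \<Rightarrow> rat"
    and V :: "nat \<Rightarrow> int \<Rightarrow> 'p padic"
  assumes m: "m \<ge> 1"
    and a_last_nonzero: "\<And>n. a (m + 1) n \<noteq> 0"
    and a_last_0: "a (m + 1) 0 = 1"
    and s_0: "\<And>i. i \<in> {1..m - 1} \<Longrightarrow> s i 0 = 0"
    and sm_0: "\<And>n. sm n 0 = 0"
    and s_approx: "\<And>i \<gamma>. i \<in> {1..m - 1} \<Longrightarrow> \<gamma> \<noteq> 0 \<Longrightarrow>
          padic_norm (\<gamma> - of_rat (s i \<gamma>)) < min (padic_norm \<gamma>) 1"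
    and sm_approx: "\<And>n \<gamma>. \<gamma> \<noteq> 0 \<Longrightarrow>
          padic_norm (\<gamma> - of_rat (sm n \<gamma>)) < min (padic_norm \<gamma>) 1"
    and sm_approx_last: "\<And>n \<gamma>. \<gamma> \<noteq> 0 \<Longrightarrow>
          padic_norm (\<gamma> - of_rat (sm n \<gamma>)) \<le> padic_norm (of_rat (a (m + 1) (n + 1)) :: 'p padic)"
    and a_step: "\<And>i n. i \<in> {1..m - 1} \<Longrightarrow> a i n = s i (\<alpha> i n)"
    and a_step_m: "\<And>n. a m n = sm n (\<alpha> m n)"
    and \<alpha>_neq: "\<And>n. \<alpha> m n \<noteq> of_rat (a m n)"
    and \<alpha>_step_1: "\<And>n. \<alpha> 1 (n + 1) = of_rat (a (m + 1) (n + 1)) / (\<alpha> m n - of_rat (a m n))"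
    and \<alpha>_step: "\<And>i n. i \<in> {2..m} \<Longrightarrow> \<alpha> i (n + 1) =
          of_rat (a (m + 1) (n + 1)) *
            ((\<alpha> (i - 1) n - of_rat (a (i - 1) n)) / (\<alpha> m n - of_rat (a m n)))"
    and \<alpha>_last: "\<And>n. \<alpha> (m + 1) n = of_rat (a (m + 1) n)"
    and A_neg: "\<And>i j. i \<in> {1..m + 1} \<Longrightarrow> j \<in> {1..m} \<Longrightarrow> A i (- int j) = (if i = j then 1 else 0)"
    and A_0: "\<And>i. i \<in> {1..m + 1} \<Longrightarrow> A i 0 = a i 0"
    and A_rec: "\<And>i n. i \<in> {1..m + 1} \<Longrightarrow> n \<ge> 1 \<Longrightarrow>
          A i (int n) = (\<Sum>j = 1..m + 1. a j n * A i (int n - int j))"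
    and V_def: "\<And>i k. i \<in> {1..m} \<Longrightarrow> k \<ge> - int m \<Longrightarrow>
          V i k = of_rat (A i k) - \<alpha> i 0 * of_rat (A (m + 1) k)"
  shows "\<forall>i\<in>{1..m}. (\<lambda>n. V i (int n)) \<longlonglongrightarrow> 0"
proof
  fix i assume i: "i \<in> {1..m}"
  define \<gamma> where "\<gamma> j n = \<alpha> j n - of_rat (a j n)" for j n
  have \<gamma>_m: "\<gamma> m n \<noteq> 0" for n
    using \<alpha>_neq by (simp add: \<gamma>_def)
  \<comment> \<open>The approximation hypotheses cover only nonzero arguments; at 0 the chosen
    rational is 0, so the remainder vanishes.\<close>
  have \<gamma>_less: "padic_norm (\<gamma> j n) < 1" if "j \<in> {1..m}" for j n
  proof (cases "j = m")
    case True
    then show ?thesis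
      using sm_approx[of "\<alpha> m n" n] sm_0[of n] by (cases "\<alpha> m n = 0") (auto simp: \<gamma>_def a_step_m)
  next
    case False
    then have j: "j \<in> {1..m - 1}" using that by auto
    show ?thesis
      using s_approx[OF j, of "\<alpha> j n"] s_0[OF j]
      by (cases "\<alpha> j n = 0") (auto simp: \<gamma>_def a_step[OF j])
  qed

  have V_neg: "V i (- int j) = (if i = j then 1 else 0)" if "j \<in> {1..m}" for j
    using that i V_def[OF i, of "- int j"] A_neg[of i j] A_neg[of "m + 1" j] by auto
  have V_rec: "V i (int n) = (\<Sum>j = 1..m + 1. of_rat (a j n) * V i (int n - int j))" if "n \<ge> 1" for n
  proof -
    have "V i (int n) = of_rat (A i (int n)) - \<alpha> i 0 * of_rat (A (m + 1) (int n))"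
      using V_def[OF i] by simp
    also have "\<dots> = (\<Sum>j = 1..m + 1. of_rat (a j n) *
        (of_rat (A i (int n - int j)) - \<alpha> i 0 * of_rat (A (m + 1) (int n - int j))))"
      using i that A_rec[of i n] A_rec[of "m + 1" n]
      by (simp add: of_rat_sum of_rat_mult of_rat_add algebra_simps sum_subtractf sum_distrib_left)
    also have "\<dots> = (\<Sum>j = 1..m + 1. of_rat (a j n) * V i (int n - int j))"
      \<comment> \<open>For n \<ge> 1 and j \<le> m + 1 the index \<open>n - j\<close> is at least
        \<open>- m\<close>, so the definition of \<open>V\<close> applies to every summand.\<close>
      using that by (intro sum.cong refl arg_cong2[where f = "(*)"] V_def[OF i, symmetric]) auto
    finally show ?thesis .
  qed

  \<comment> \<open>The convention for the last row of \<alpha> extends the recursion to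
    \<open>j = m\<close>, where \<gamma> cancels; the induction below can thus treat all
    \<open>j\<close> alike.\<close>
  have \<alpha>_Suc: "\<alpha> (j + 1) (n + 1) = of_rat (a (m + 1) (n + 1)) / \<gamma> m n * \<gamma> j n"
    if "j \<in> {1..m}" for j n
  proof (cases "j = m")
    case True
    then show ?thesis using \<gamma>_m[of n] \<alpha>_last[of "n + 1"] by simp
  next
    case False
    then show ?thesis using that \<alpha>_step[of "j + 1" n] by (simp add: \<gamma>_def)
  qed

  have V_sum: "V i (int n) + (\<Sum>j = 1..m. \<gamma> j n * V i (int n - int j)) = 0" for n
  proof (induction n)
    case 0
    \<comment> \<open>The initial values leave only the term \<open>j = i\<close>, and it cancels
      \<open>V i 0 = a i 0 - \<alpha> i 0\<close>.\<close>
    have "(\<Sum>j = 1..m. \<gamma> j 0 * V i (int 0 - int j)) = (\<Sum>j = 1..m. if i = j then \<gamma> j 0 else 0)"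
      using V_neg by (intro sum.cong) auto
    also have "\<dots> = \<gamma> i 0" using i by simp
    finally show ?case
      using i V_def[OF i, of 0] A_0[of i] A_0[of "m + 1"] a_last_0 by (simp add: \<gamma>_def)
  next
    case (Suc n)
    define W where "W j = V i (int (Suc n) - int j)" for j
    define c where "c = of_rat (a (m + 1) (n + 1)) / \<gamma> m n"
    \<comment> \<open>Adding the remainders to the recurrence for \<open>V\<close> replaces each
      coefficient \<open>a\<close> by \<alpha>; at \<open>m + 1\<close> the two already agree.
      Splitting off \<open>j = 1\<close> and shifting then exposes the relation at \<open>n\<close>,
      multiplied by \<open>c\<close>.\<close>
    have "V i (int (Suc n)) + (\<Sum>j = 1..m. \<gamma> j (Suc n) * W j)
        = (\<Sum>j = 1..m + 1. \<alpha> j (Suc n) * W j)"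
      using V_rec[of "Suc n"] \<alpha>_last[of "Suc n"]
      by (simp add: W_def \<gamma>_def algebra_simps sum_subtractf)
    also have "\<dots> = \<alpha> 1 (n + 1) * W 1 + (\<Sum>j = 1..m. \<alpha> (j + 1) (n + 1) * W (j + 1))"
      by (simp add: sum.atLeast_Suc_atMost sum.shift_bounds_cl_Suc_ivl del: sum.cl_ivl_Suc)
    also have "(\<Sum>j = 1..m. \<alpha> (j + 1) (n + 1) * W (j + 1)) = c * (\<Sum>j = 1..m. \<gamma> j n * W (j + 1))"
      unfolding sum_distrib_left using \<alpha>_Suc by (intro sum.cong) (auto simp: c_def)
    also have "\<alpha> 1 (n + 1) * W 1 = c * V i (int n)"
      using \<alpha>_step_1[of n] by (simp add: W_def c_def \<gamma>_def)
    also have "c * V i (int n) + c * (\<Sum>j = 1..m. \<gamma> j n * W (j + 1))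
        = c * (V i (int n) + (\<Sum>j = 1..m. \<gamma> j n * V i (int n - int j)))"
      by (simp add: W_def distrib_left)
    also have "\<dots> = 0" using Suc.IH by simp
    finally show ?case by (simp add: W_def)
  qed

  \<comment> \<open>The shift by \<open>m\<close> makes the values of \<open>V\<close> at
    \<open>- m\<close>, ..., -1 the initial block of a sequence indexed by naturals.\<close>
  define u where "u n = padic_norm (V i (int n - int m))" for n
  have "u \<longlonglongrightarrow> 0"
  proof (rule tendsto_0_if_contracts_predecessor[OF m, where c = "1 / real CARD('p)"])
    show "1 / real CARD('p) < 1"
      using prime_gt_1_nat[OF prime_card[where 'a = 'p]] by simp
  next
    fix n assume n: "m \<le> n"
    define k where "k = n - m"
    have k: "int n - int m = int k" "\<And>j. j \<le> m \<Longrightarrow> int (n - j) - int m = int k - int j"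
      using n by (auto simp: k_def)
    have "V i (int k) = - (\<Sum>j = 1..m. \<gamma> j k * V i (int k - int j))"
      using V_sum[of k] by (simp add: eq_neg_iff_add_eq_0)
    then obtain j where j: "j \<in> {1..m}"
      "padic_norm (V i (int k)) \<le> padic_norm (\<gamma> j k * V i (int k - int j))"
      using m padic_norm_sum_le[of "{1..m}" "\<lambda>j. \<gamma> j k * V i (int k - int j)"]
      by auto
    note j(2)
    also have "padic_norm (\<gamma> j k * V i (int k - int j))
        \<le> 1 / real CARD('p) * padic_norm (V i (int k - int j))"
      unfolding padic_norm_mult
      using padic_norm_less_1_imp_le[OF \<gamma>_less[OF j(1), of k]] padic_norm_ge_0
      by (intro mult_right_mono)
    finally show "\<exists>j\<in>{1..m}. u n \<le> 1 / real CARD('p) * u (n - j)"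
      using j(1) by (intro bexI[of _ j]) (auto simp: u_def k simp del: of_nat_diff)
  qed (simp_all add: u_def padic_norm_ge_0)
  then have "(\<lambda>n. u (n + m)) \<longlonglongrightarrow> 0"
    by (rule LIMSEQ_ignore_initial_segment)
  then show "(\<lambda>n. V i (int n)) \<longlonglongrightarrow> 0"
    by (subst tendsto_dist_iff) (simp add: u_def dist_padic_def)
qed

end
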